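(* Let $G$ be a graph on $n$ vertices. Then $\operatorname{th}_{\gamma_P}(G)=n-1$ if and only if $G\simeq P_3\,\dot\cup\,\overline{K}_{n-3}$ or $G\simeq C_3\,\dot\cup\,\overline{K}_{n-3}$ or $G\simeq P_4\,\dot\cup\,\overline{K}_{n-4}$ or $G\simeq C_4\,\dot\cup\,\overline{K}_{n-4}$ or $G\simeq K_2\,\dot\cup\,K_2\,\dot\cup\,\overline{K}_{n-4}$.
   Context: All graphs are finite, simple, undirected, and have at least one vertex. $P_m$, $C_m$, $K_m$ are the path, cycle and complete graph on $m$ vertices, and $\overline{K}_m$ is the graph on $m$ vertices with no edges (when $m=0$ this term is omitted from a disjoint union, and a listed graph is disregarded if $m<0$); $\dot\cup$ is disjoint union; $\simeq$ is graph isomorphism. For $S\subseteq V(G)$, $N[S]$ is the set of vertices in $S$ or adjacent to a vertex of $S$. Given $G=(V,E)$ and $S\subseteq V$, initially (timestep $0$) the vertices of $S$ are colored; in timestep $1$ every vertex in $N[S]$ becomes colored; in each subsequent timestep, every vertex which is the only non-colored neighbor of some colored vertex becomes colored. $S$ is a power dominating set if all vertices eventually become colored, and then $\operatorname{ppt}(G;S)$ is the number of timesteps needed to color all of $G$ (so $\operatorname{ppt}(G;V)=0$). The power domination throttling number is $\operatorname{th}_{\gamma_P}(G)=\min\{|S|+\operatorname{ppt}(G;S): S \text{ a power dominating set of } G\}$. *)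

theory Defs
  imports "Graph_Theory.Graph_Theory"
begin

text \<open>
  Finite simple undirected graphs are the locale \<^locale>\<open>pair_graph\<close>: finite, symmetric,
  loop-free sets of vertex pairs. That locale admits the graph without vertices.
\<close>

abbreviation graph_iso :: "'a pair_pre_digraph \<Rightarrow> 'b pair_pre_digraph \<Rightarrow> bool"
    (infix \<open>\<simeq>\<close> 50) where
  "G \<simeq> H \<equiv> digraph_iso (with_proj G) (with_proj H)"

definition disjoint_union ::
    "'a pair_pre_digraph \<Rightarrow> 'b pair_pre_digraph \<Rightarrow> ('a + 'b) pair_pre_digraph"
    (infixl \<open>\<uplus>\<close> 65) where
  "G \<uplus> H = \<lparr> pverts = pverts G <+> pverts H,
             parcs = map_prod Inl Inl ` parcs G \<union> map_prod Inr Inr ` parcs H \<rparr>"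

definition path_graph :: "nat \<Rightarrow> nat pair_pre_digraph" where
  "path_graph m = \<lparr> pverts = {..<m},
     parcs = {(i, j). i < m \<and> j < m \<and> (j = Suc i \<or> i = Suc j)} \<rparr>"

text \<open>A cycle only for \<open>m \<ge> 3\<close>.\<close>

definition cycle_graph :: "nat \<Rightarrow> nat pair_pre_digraph" where
  "cycle_graph m = \<lparr> pverts = {..<m},
     parcs = {(i, j). i < m \<and> j < m \<and> i \<noteq> j \<and> (j = Suc i mod m \<or> i = Suc j mod m)} \<rparr>"

definition complete_graph :: "nat \<Rightarrow> nat pair_pre_digraph" where
  "complete_graph m = \<lparr> pverts = {..<m}, parcs = {(i, j). i < m \<and> j < m \<and> i \<noteq> j} \<rparr>"

definition empty_graph :: "nat \<Rightarrow> nat pair_pre_digraph" where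
  "empty_graph m = \<lparr> pverts = {..<m}, parcs = {} \<rparr>"

definition neighbors :: "'a pair_pre_digraph \<Rightarrow> 'a \<Rightarrow> 'a set" where
  "neighbors G v = {w. v \<rightarrow>\<^bsub>G\<^esub> w}"

definition closed_nbhd :: "'a pair_pre_digraph \<Rightarrow> 'a set \<Rightarrow> 'a set" where
  "closed_nbhd G S = S \<union> (\<Union>v\<in>S. neighbors G v)"

definition force_step :: "'a pair_pre_digraph \<Rightarrow> 'a set \<Rightarrow> 'a set" where
  "force_step G C = C \<union> {w. \<exists>v\<in>C. neighbors G v - C = {w}}"

fun colored :: "'a pair_pre_digraph \<Rightarrow> 'a set \<Rightarrow> nat \<Rightarrow> 'a set" where
  "colored G S 0 = S"
| "colored G S (Suc 0) = closed_nbhd G S"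
| "colored G S (Suc (Suc t)) = force_step G (colored G S (Suc t))"

definition power_dominating :: "'a pair_pre_digraph \<Rightarrow> 'a set \<Rightarrow> bool" where
  "power_dominating G S \<longleftrightarrow> S \<subseteq> pverts G \<and> (\<exists>t. colored G S t = pverts G)"

text \<open>Only meaningful for power dominating \<open>S\<close>.\<close>

definition ppt :: "'a pair_pre_digraph \<Rightarrow> 'a set \<Rightarrow> nat" where
  "ppt G S = (LEAST t. colored G S t = pverts G)"

definition pd_throttling :: "'a pair_pre_digraph \<Rightarrow> nat" where
  "pd_throttling G = Min {card S + ppt G S | S. power_dominating G S}"

text \<open>Well-definedness of the minimum.\<close>

lemma power_dominating_pverts: "power_dominating G (pverts G)"
  unfolding power_dominating_def by (auto intro: exI[of _ 0])

lemma ppt_pverts: "ppt G (pverts G) = 0"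
  unfolding ppt_def by (rule Least_equality) auto

lemma pd_throttling_set:
  assumes "pair_graph G"
  shows "finite {card S + ppt G S | S. power_dominating G S}"
    and "{card S + ppt G S | S. power_dominating G S} \<noteq> {}"
proof -
  interpret pair_graph G by fact
  have "{card S + ppt G S | S. power_dominating G S} \<subseteq> (\<lambda>S. card S + ppt G S) ` Pow (pverts G)"
    unfolding power_dominating_def by auto
  then show "finite {card S + ppt G S | S. power_dominating G S}"
    by (rule finite_subset) (simp add: pair_finite_verts)
  show "{card S + ppt G S | S. power_dominating G S} \<noteq> {}"
    using power_dominating_pverts by blast
qed

lemma pair_graphI:
  assumes "finite (pverts G)" "parcs G \<subseteq> pverts G \<times> pverts G" "sym (parcs G)" "irrefl (parcs G)"
  shows "pair_graph G"
proof -
  have "finite (parcs G)"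
    using assms(1,2) by (meson finite_SigmaI finite_subset)
  then show ?thesis
    using assms by unfold_locales (auto simp: symmetric_def irrefl_def)
qed

lemma pair_graph_path_graph: "pair_graph (path_graph m)"
  by (rule pair_graphI) (auto simp: path_graph_def sym_def irrefl_def)

lemma pair_graph_cycle_graph: "pair_graph (cycle_graph m)"
  by (rule pair_graphI) (auto simp: cycle_graph_def sym_def irrefl_def)

lemma pair_graph_empty_graph: "pair_graph (empty_graph m)"
  by (rule pair_graphI) (auto simp: empty_graph_def sym_def irrefl_def)

lemma pair_graph_complete_graph: "pair_graph (complete_graph m)"
  by (rule pair_graphI) (auto simp: complete_graph_def sym_def irrefl_def)

lemma complete_graph_complete_digraph: "K\<^bsub>m\<^esub> (with_proj (complete_graph m))"
  by (auto simp: complete_digraph_pair_def complete_graph_def)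

lemma pair_graph_disjoint_union:
  assumes "pair_graph G" "pair_graph H"
  shows "pair_graph (G \<uplus> H)"
proof -
  interpret G: pair_graph G by fact
  interpret H: pair_graph H by fact
  show ?thesis
  proof (rule pair_graphI)
    show "finite (pverts (G \<uplus> H))"
      using G.pair_finite_verts H.pair_finite_verts by (simp add: disjoint_union_def)
    show "parcs (G \<uplus> H) \<subseteq> pverts (G \<uplus> H) \<times> pverts (G \<uplus> H)"
      by (auto simp: disjoint_union_def dest: G.in_arcsD1 G.in_arcsD2 H.in_arcsD1 H.in_arcsD2)
    have "sym (parcs G)" "sym (parcs H)"
      using G.pair_sym_arcs H.pair_sym_arcs by (simp_all add: symmetric_def)
    then show "sym (parcs (G \<uplus> H))"
      unfolding sym_def disjoint_union_def by auto
    show "irrefl (parcs (G \<uplus> H))"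
      by (auto simp: disjoint_union_def irrefl_def dest: G.pair_no_loops H.pair_no_loops)
  qed
qed

text \<open>For pair digraphs \<^const>\<open>digraph_iso\<close> is adjacency-preserving bijection of the vertices.\<close>

lemma graph_iso_iff:
  assumes "pair_wf_digraph G" "pair_wf_digraph H"
  shows "G \<simeq> H \<longleftrightarrow> (\<exists>f. bij_betw f (pverts G) (pverts H) \<and>
    (\<forall>u\<in>pverts G. \<forall>v\<in>pverts G. (u, v) \<in> parcs G \<longleftrightarrow> (f u, f v) \<in> parcs H))"
proof -
  interpret G: pair_wf_digraph G by fact
  interpret H: pair_wf_digraph H by fact
  show ?thesis
  proof
    assume "G \<simeq> H"
    then obtain h where h: "G.digraph_isomorphism h" and H: "with_proj H = app_iso h (with_proj G)"
      unfolding digraph_iso_def by blast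
    let ?f = "iso_verts h"
    have V: "pverts H = ?f ` pverts G" and A: "parcs H = iso_arcs h ` parcs G"
      and t: "iso_tail h = fst" and hd: "iso_head h = snd"
      using H by (auto simp: with_proj_def app_iso_def)
    have inj: "inj_on ?f (pverts G)"
      using h by (auto simp: G.digraph_isomorphism_def)
    have arc: "iso_arcs h a = (?f (fst a), ?f (snd a))" if "a \<in> parcs G" for a
      using h that t hd by (auto simp: G.digraph_isomorphism_def prod_eq_iff)
    have "(u, v) \<in> parcs G \<longleftrightarrow> (?f u, ?f v) \<in> parcs H" if "u \<in> pverts G" "v \<in> pverts G" for u v
    proof
      assume "(u, v) \<in> parcs G"
      then show "(?f u, ?f v) \<in> parcs H"
        using arc[of "(u, v)"] A by (metis fst_conv imageI snd_conv)
    next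
      assume "(?f u, ?f v) \<in> parcs H"
      then obtain a where a: "a \<in> parcs G" "(?f u, ?f v) = iso_arcs h a"
        using A by auto
      then have "?f u = ?f (fst a)" "?f v = ?f (snd a)"
        using arc by auto
      then have "u = fst a" "v = snd a"
        using inj that a(1) G.arc_fst_in_verts G.arc_snd_in_verts by (auto dest: inj_onD)
      then show "(u, v) \<in> parcs G"
        using a(1) by simp
    qed
    then show "\<exists>f. bij_betw f (pverts G) (pverts H) \<and>
        (\<forall>u\<in>pverts G. \<forall>v\<in>pverts G. (u, v) \<in> parcs G \<longleftrightarrow> (f u, f v) \<in> parcs H)"
      using V inj by (auto simp: bij_betw_def intro!: exI[of _ ?f])
  next
    assume "\<exists>f. bij_betw f (pverts G) (pverts H) \<and>
        (\<forall>u\<in>pverts G. \<forall>v\<in>pverts G. (u, v) \<in> parcs G \<longleftrightarrow> (f u, f v) \<in> parcs H)"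
    then obtain f where inj: "inj_on f (pverts G)" and V: "pverts H = f ` pverts G"
      and A: "\<And>u v. u \<in> pverts G \<Longrightarrow> v \<in> pverts G \<Longrightarrow> (u, v) \<in> parcs G \<longleftrightarrow> (f u, f v) \<in> parcs H"
      by (auto simp: bij_betw_def)
    let ?h = "\<lparr> iso_verts = f, iso_arcs = map_prod f f, iso_head = snd, iso_tail = fst \<rparr>"
    have "parcs H \<subseteq> map_prod f f ` parcs G"
    proof
      fix e assume e: "e \<in> parcs H"
      obtain x y where xy: "e = (x, y)"
        by (cases e)
      then have "x \<in> f ` pverts G" "y \<in> f ` pverts G"
        using e H.in_arcsD1 H.in_arcsD2 V by simp_all
      then obtain u v where "u \<in> pverts G" "v \<in> pverts G" "e = (f u, f v)"
        using xy by blast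
      then show "e \<in> map_prod f f ` parcs G"
        using A[of u v] e by (intro image_eqI[of _ _ "(u, v)"]) auto
    qed
    moreover have "map_prod f f ` parcs G \<subseteq> parcs H"
    proof
      fix e assume "e \<in> map_prod f f ` parcs G"
      then obtain u v where "(u, v) \<in> parcs G" "e = (f u, f v)"
        by auto
      then show "e \<in> parcs H"
        using A[of u v] G.in_arcsD1[of u v] G.in_arcsD2[of u v] by simp
    qed
    ultimately have "parcs H = map_prod f f ` parcs G"
      by blast
    then have "with_proj H = app_iso ?h (with_proj G)"
      using V by (simp add: with_proj_def app_iso_def)
    moreover have "inj_on (map_prod f f) (parcs G)"
      by (rule inj_on_subset[OF map_prod_inj_on[OF inj inj]])
        (auto dest: G.in_arcsD1 G.in_arcsD2)
    then have "G.digraph_isomorphism ?h"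
      using inj G.wf_digraph by (auto simp: G.digraph_isomorphism_def)
    ultimately show "G \<simeq> H"
      unfolding digraph_iso_def by blast
  qed
qed

end

theory Submission
  imports Defs
begin

text \<open>
  Call \<open>U\<close> outward if every vertex of \<open>U\<close> has a neighbor outside \<open>U\<close>, so that \<open>V - U\<close> colors
  everything in one timestep. If \<open>U\<close> is an outward set of maximum size and \<open>W\<close> is the set of
  non-isolated vertices, then \<open>W - U\<close> is outward too, whence \<open>|W| \<le> 2 |U|\<close>. Isolated vertices must
  be colored initially, so when \<open>|U| \<le> 2\<close> a power dominating set leaves at most \<open>2 |U| - 1\<close> vertices
  uncolored, and one needing a single timestep leaves an outward set uncolored. Hence the throttling
  number is \<open>n - 1\<close> iff the largest outward sets have exactly two vertices. Then \<open>W\<close> has three or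
  four vertices, each with at most two neighbors, which leaves the five graphs.
\<close>

section \<open>Sets dominated by their complement\<close>

definition outward :: "'a pair_pre_digraph \<Rightarrow> 'a set \<Rightarrow> bool" where
  "outward G U \<longleftrightarrow> (\<forall>u\<in>U. \<exists>v. (u, v) \<in> parcs G \<and> v \<notin> U)"

lemma neighbors_iff [simp]: "w \<in> neighbors G v \<longleftrightarrow> (v, w) \<in> parcs G"
  by (simp add: neighbors_def)

lemma outward_subset: "outward G U \<Longrightarrow> U' \<subseteq> U \<Longrightarrow> outward G U'"
  unfolding outward_def by blast

lemma outward_subset_Domain: "outward G U \<Longrightarrow> U \<subseteq> Domain (parcs G)"
  unfolding outward_def by blast

text \<open>Outwardness passes to subsets, so excluding outward sets of one exact size excludes all
  larger ones.\<close>

lemma outward_card_smaller: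
  assumes "outward G U" "k \<le> card U"
  shows "\<exists>U'. outward G U' \<and> card U' = k"
  using assms by (metis obtain_subset_with_card_n outward_subset)

context pair_graph
begin

lemma sym_parcs: "(u, v) \<in> parcs G \<Longrightarrow> (v, u) \<in> parcs G"
  using pair_sym_arcs by (auto simp: symmetric_def dest: symD)

lemma no_loops: "(v, v) \<notin> parcs G"
  using pair_no_loops by fastforce

lemma finite_Domain_parcs: "finite (Domain (parcs G))"
  by (simp add: finite_Domain)

lemma Domain_parcs_subset: "Domain (parcs G) \<subseteq> pverts G"
  using in_arcsD1 by auto

text \<open>Ore's bound on domination in another form: within the non-isolated vertices, the
  complement of a largest outward set is a smallest dominating set, which has at most half of these
  vertices.\<close>

lemma card_Domain_parcs_le:
  assumes "\<And>U. outward G U \<Longrightarrow> card U \<le> k"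
  shows "card (Domain (parcs G)) \<le> 2 * k"
proof -
  let ?W = "Domain (parcs G)"
  have "outward G {}"
    by (simp add: outward_def)
  then have "\<exists>U. outward G U \<and> (\<forall>U'. outward G U' \<longrightarrow> card U' \<le> card U)"
    by (rule ex_has_greatest_nat[where b = "Suc k"]) (simp add: assms less_Suc_eq_le)
  then obtain U where U: "outward G U" and max: "\<And>U'. outward G U' \<Longrightarrow> card U' \<le> card U"
    by blast
  have UW: "U \<subseteq> ?W" and finU: "finite U"
    using outward_subset_Domain[OF U] finite_Domain_parcs finite_subset by auto
  \<comment> \<open>If \<open>v\<close> had no neighbor in \<open>U\<close>, then \<open>insert v U\<close> would be a larger such set.\<close>
  have "\<exists>u\<in>U. (v, u) \<in> parcs G" if v: "v \<in> ?W - U" for v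
  proof (rule ccontr)
    assume no: "\<not> (\<exists>u\<in>U. (v, u) \<in> parcs G)"
    obtain w where w: "(v, w) \<in> parcs G"
      using v by blast
    then have "w \<notin> insert v U"
      using no no_loops by blast
    \<comment> \<open>The outside neighbor that \<open>u\<close> already has differs from
      \<open>v\<close>, because \<open>v\<close> is adjacent to nothing in \<open>U\<close>.\<close>
    moreover have "\<exists>x. (u, x) \<in> parcs G \<and> x \<notin> insert v U" if "u \<in> U" for u
      using that U no sym_parcs unfolding outward_def by blast
    ultimately have "outward G (insert v U)"
      using w unfolding outward_def by blast
    from max[OF this] show False
      using v finU by simp
  qed
  then have "outward G (?W - U)"
    unfolding outward_def by blast
  then have "card (?W - U) \<le> card U"
    by (rule max)
  moreover have "card U \<le> k"
    using assms U by blast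
  ultimately show ?thesis
    using card_Diff_subset[OF finU UW] by linarith
qed

section \<open>Throttling in terms of outward sets\<close>

lemma pd_throttling_le_iff:
  "pd_throttling G \<le> m \<longleftrightarrow> (\<exists>S. power_dominating G S \<and> card S + ppt G S \<le> m)"
  using Min_le_iff[OF pd_throttling_set, OF pair_graph_axioms pair_graph_axioms]
  unfolding pd_throttling_def by blast

text \<open>Start from all vertices outside \<open>U\<close>; the first timestep colors
  \<open>U\<close>. Only \<open>ppt \<le> 1\<close> is claimed, so an empty \<open>U\<close> is no
  special case.\<close>

lemma pd_throttling_le_of_outward:
  assumes U: "outward G U"
  shows "pd_throttling G \<le> card (pverts G) - card U + 1"
proof -
  let ?S = "pverts G - U"
  have UV: "U \<subseteq> pverts G"
    using outward_subset_Domain[OF U] Domain_parcs_subset by blast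
  have "\<exists>v\<in>?S. (v, u) \<in> parcs G" if "u \<in> U" for u
    using U that sym_parcs in_arcsD2 unfolding outward_def by blast
  then have 1: "colored G ?S 1 = pverts G"
    using UV in_arcsD2 by (auto simp: closed_nbhd_def)
  then have "power_dominating G ?S"
    unfolding power_dominating_def by blast
  moreover have "ppt G ?S \<le> 1"
    unfolding ppt_def using 1 by (rule Least_le)
  moreover have "card ?S = card (pverts G) - card U"
    using UV pair_finite_verts finite_subset card_Diff_subset by metis
  ultimately show ?thesis
    unfolding pd_throttling_le_iff by auto
qed

section \<open>Lower bound on the cost of a power dominating set\<close>

lemma neighbors_subset_Domain: "neighbors G v \<subseteq> Domain (parcs G)"
  using sym_parcs by (meson DomainI neighbors_iff subsetI)

text \<open>Color travels along edges only, so an isolated vertex is colored initially or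
  never.\<close>

lemma colored_subset: "colored G S t \<subseteq> S \<union> Domain (parcs G)"
proof (induction t)
  case (Suc t)
  have "force_step G C \<subseteq> C \<union> Domain (parcs G)" "closed_nbhd G C \<subseteq> C \<union> Domain (parcs G)" for C
    using neighbors_subset_Domain unfolding force_step_def closed_nbhd_def by blast+
  then show ?case
    using Suc by (cases t) (simp_all, blast)
qed simp

text \<open>If the first timestep adds nothing, no colored vertex has an uncolored neighbor, and no
  later force can occur.\<close>

lemma colored_stalls:
  assumes "closed_nbhd G S = S"
  shows "colored G S t = S"
proof -
  have "force_step G S = S"
    using assms unfolding closed_nbhd_def force_step_def by blast
  then have "colored G S (Suc t) = S" for t
    using assms by (induction t) auto
  then show ?thesis
    by (cases t) auto
qed

text \<open>The claim amounts to |V - S| \<le> ppt + k - 1. One timestep leaves an outward set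
  uncolored, of size at most k. With two or more timesteps the general bound 2k - 1 is enough, since
  \<open>k \<le> 2\<close> makes it at most k + 1.\<close>

lemma card_le_card_add_ppt:
  assumes S: "power_dominating G S"
    and k: "1 \<le> k" "k \<le> 2"
    and out: "\<And>U. outward G U \<Longrightarrow> card U \<le> k"
  shows "card (pverts G) \<le> card S + ppt G S + (k - 1)"
proof (cases "S = pverts G")
  case False
  let ?W = "Domain (parcs G)" and ?U = "pverts G - S"
  have SV: "S \<subseteq> pverts G" and "\<exists>t. colored G S t = pverts G"
    using S by (auto simp: power_dominating_def)
  then have ppt: "colored G S (ppt G S) = pverts G"
    unfolding ppt_def by (metis (mono_tags, lifting) LeastI_ex)
  then have UW: "?U \<subseteq> ?W"
    using colored_subset[of S "ppt G S"] by blast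
  \<comment> \<open>Some vertex of \<open>S\<close> must have a neighbor for the coloring to start.
    It lies in \<open>?W\<close> but not in \<open>?U\<close>, and this improves the bound 2k on
    \<open>card ?U\<close> by one.\<close>
  have "closed_nbhd G S \<noteq> S"
    using ppt False colored_stalls by metis
  then obtain s u where "s \<in> S" "u \<in> neighbors G s"
    unfolding closed_nbhd_def by blast
  then have "s \<in> S" "s \<in> ?W"
    by auto
  then have "?U \<subset> ?W"
    using UW by blast
  then have "card ?U < card ?W"
    by (simp add: psubset_card_mono finite_Domain_parcs)
  then have U: "card ?U < 2 * k"
    using card_Domain_parcs_le[OF out] by linarith
  have card: "card (pverts G) = card S + card ?U"
    using SV pair_finite_verts by (metis card_Diff_subset card_mono finite_subset le_add_diff_inverse)
  consider "ppt G S = 0" | "ppt G S = 1" | "ppt G S \<ge> 2"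
    by linarith
  then show ?thesis
  proof cases
    case 1
    then show ?thesis
      using ppt False by simp
  next
    case 2
    then have "closed_nbhd G S = pverts G"
      using ppt by simp
    then have "outward G ?U"
      unfolding outward_def closed_nbhd_def using sym_parcs by fastforce
    then show ?thesis
      using out card 2 k by fastforce
  next
    case 3
    then show ?thesis
      using U card k by linarith
  qed
qed auto

text \<open>Outward pairs correspond to throttling number at most n - 1, outward triples to at most
  n - 2; equality is the first without the second.\<close>

lemma pd_throttling_eq_iff_outward:
  assumes "pverts G \<noteq> {}"
  shows "pd_throttling G = card (pverts G) - 1 \<longleftrightarrow>
    (\<exists>U. outward G U \<and> card U = 2) \<and> \<not> (\<exists>U. outward G U \<and> card U = 3)"
proof -
  let ?n = "card (pverts G)"
  have n: "0 < ?n"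
    using assms pair_finite_verts by (simp add: card_gt_0_iff)
  have le: "card U \<le> ?n" if "outward G U" for U
    using outward_subset_Domain[OF that] Domain_parcs_subset pair_finite_verts
    by (meson card_mono subset_trans)
  \<comment> \<open>The condition \<open>k \<le> ?n\<close> keeps the natural subtraction
    exact.\<close>
  have iff: "pd_throttling G \<le> ?n - k \<longleftrightarrow> (\<exists>U. outward G U \<and> card U = Suc k)"
    if k: "1 \<le> k" "k \<le> 2" "k \<le> ?n" for k
  proof
    assume "pd_throttling G \<le> ?n - k"
    then obtain S where S: "power_dominating G S" "card S + ppt G S \<le> ?n - k"
      unfolding pd_throttling_le_iff by blast
    show "\<exists>U. outward G U \<and> card U = Suc k"
    proof (rule ccontr)
      assume "\<not> ?thesis"
      then have "card U \<le> k" if "outward G U" for U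
        using outward_card_smaller[OF that, of "Suc k"] by force
      from card_le_card_add_ppt[OF S(1) k(1,2) this] show False
        using S(2) k by linarith
    qed
  next
    assume "\<exists>U. outward G U \<and> card U = Suc k"
    then show "pd_throttling G \<le> ?n - k"
      using pd_throttling_le_of_outward le by fastforce
  qed
  show ?thesis
  \<comment> \<open>For one vertex, \<open>?n - 2\<close> truncates to \<open>?n - 1\<close> and the
    two thresholds coincide. Both sides are then false, as no outward pair fits into one
    vertex.\<close>
  proof (cases "?n = 1")
    case True
    have "pd_throttling G \<noteq> 0"
      using iff[of 1] le True by force
    then show ?thesis
      using True le by force
  next
    case False
    then have "pd_throttling G = ?n - 1 \<longleftrightarrow>
        pd_throttling G \<le> ?n - 1 \<and> \<not> pd_throttling G \<le> ?n - 2"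
      using n by linarith
    then show ?thesis
      using iff[of 1] iff[of 2] n False by (simp add: numeral_2_eq_2 numeral_3_eq_3)
  qed
qed

end

section \<open>Isomorphism to a graph with isolated vertices added\<close>

text \<open>Taking the inverse bijection, from \<open>H\<close> to \<open>G\<close>, presents the
  arcs of \<open>G\<close> as an image, so that an explicit arc set of \<open>H\<close> can be
  carried over directly.\<close>

lemma graph_iso_iff_image:
  assumes "pair_wf_digraph G" "pair_wf_digraph H"
  shows "G \<simeq> H \<longleftrightarrow>
    (\<exists>h. bij_betw h (pverts H) (pverts G) \<and> parcs G = map_prod h h ` parcs H)"
proof -
  interpret G: pair_wf_digraph G by fact
  interpret H: pair_wf_digraph H by fact
  show ?thesis
    unfolding graph_iso_iff[OF assms]
  proof (safe, goal_cases)
    case (1 f)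
    let ?h = "inv_into (pverts G) f"
    have h: "?h (f u) = u" if "u \<in> pverts G" for u
      using 1(1) that by (simp add: bij_betw_inv_into_left)
    have f: "?h w \<in> pverts G" "f (?h w) = w" if "w \<in> pverts H" for w
      using 1(1) that by (auto simp: bij_betw_inv_into_right bij_betw_def inv_into_into)
    have "parcs G \<subseteq> map_prod ?h ?h ` parcs H"
    proof
      fix e assume e: "e \<in> parcs G"
      then have V: "fst e \<in> pverts G" "snd e \<in> pverts G"
        by auto
      then have "(f (fst e), f (snd e)) \<in> parcs H"
        using 1(2) e by (metis prod.collapse)
      then show "e \<in> map_prod ?h ?h ` parcs H"
        using V h by (intro image_eqI[of _ _ "(f (fst e), f (snd e))"]) auto
    qed
    moreover have "map_prod ?h ?h ` parcs H \<subseteq> parcs G"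
    proof
      fix e assume "e \<in> map_prod ?h ?h ` parcs H"
      then obtain x y where xy: "(x, y) \<in> parcs H" "e = (?h x, ?h y)"
        by auto
      then have V: "x \<in> pverts H" "y \<in> pverts H"
        using H.in_arcsD1 H.in_arcsD2 by simp_all
      then have "(f (?h x), f (?h y)) \<in> parcs H"
        using f(2) xy(1) by simp
      then show "e \<in> parcs G"
        using 1(2) f(1) V xy(2) by blast
    qed
    ultimately show ?case
      using bij_betw_inv_into[OF 1(1)] by blast
  next
    case (2 h)
    let ?f = "inv_into (pverts H) h"
    have inj: "inj_on h (pverts H)"
      using 2(1) by (simp add: bij_betw_def)
    have f: "?f u \<in> pverts H" "h (?f u) = u" if "u \<in> pverts G" for u
      using 2(1) that by (auto simp: bij_betw_inv_into_right bij_betw_def inv_into_into)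
    have "(u, v) \<in> parcs G \<longleftrightarrow> (?f u, ?f v) \<in> parcs H"
      if uv: "u \<in> pverts G" "v \<in> pverts G" for u v
    proof
      assume "(u, v) \<in> parcs G"
      then obtain x y where xy: "(x, y) \<in> parcs H" "u = h x" "v = h y"
        using 2(2) by auto
      then show "(?f u, ?f v) \<in> parcs H"
        using inj H.in_arcsD1[OF xy(1)] H.in_arcsD2[OF xy(1)] by simp
    next
      assume "(?f u, ?f v) \<in> parcs H"
      then show "(u, v) \<in> parcs G"
        using 2(2) f uv by (metis image_eqI map_prod_simp)
    qed
    then show ?case
      using bij_betw_inv_into[OF 2(1)] by blast
  qed
qed

text \<open>The added vertices carry no arcs, so an isomorphism is determined up to the placement of
  isolated vertices by an embedding of \<open>H\<close> that covers every arc of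
  \<open>G\<close>.\<close>

lemma graph_iso_union_empty_iff:
  assumes "pair_graph G" "pair_graph H"
  shows "card (pverts G) \<ge> card (pverts H) \<and>
      G \<simeq> H \<uplus> empty_graph (card (pverts G) - card (pverts H)) \<longleftrightarrow>
    (\<exists>g. inj_on g (pverts H) \<and> g ` pverts H \<subseteq> pverts G \<and> parcs G = map_prod g g ` parcs H)"
proof -
  interpret G: pair_graph G by fact
  interpret H: pair_graph H by fact
  let ?m = "card (pverts G) - card (pverts H)"
  let ?H = "H \<uplus> empty_graph ?m"
  interpret U: pair_graph ?H
    using assms(2) pair_graph_empty_graph by (rule pair_graph_disjoint_union)
  have V: "pverts ?H = pverts H <+> {..<?m}" and A: "parcs ?H = map_prod Inl Inl ` parcs H"
    by (auto simp: disjoint_union_def empty_graph_def)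
  have iso: "G \<simeq> ?H \<longleftrightarrow> (\<exists>h. bij_betw h (pverts H <+> {..<?m}) (pverts G) \<and>
      parcs G = map_prod (h \<circ> Inl) (h \<circ> Inl) ` parcs H)"
    unfolding graph_iso_iff_image[OF G.pair_wf_digraph_axioms U.pair_wf_digraph_axioms] V A
    by (simp add: image_image map_prod_compose[symmetric] prod.map_comp)
  show ?thesis
  proof
    assume "card (pverts G) \<ge> card (pverts H) \<and> G \<simeq> ?H"
    then obtain h where h: "bij_betw h (pverts H <+> {..<?m}) (pverts G)"
      and arcs: "parcs G = map_prod (h \<circ> Inl) (h \<circ> Inl) ` parcs H"
      using iso by blast
    have "inj_on (h \<circ> Inl) (pverts H)"
      using h by (auto simp: bij_betw_def inj_on_def)
    moreover have "(h \<circ> Inl) ` pverts H \<subseteq> pverts G"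
      using h by (auto simp: bij_betw_def)
    ultimately show "\<exists>g. inj_on g (pverts H) \<and> g ` pverts H \<subseteq> pverts G \<and>
        parcs G = map_prod g g ` parcs H"
      using arcs by blast
  next
    assume "\<exists>g. inj_on g (pverts H) \<and> g ` pverts H \<subseteq> pverts G \<and> parcs G = map_prod g g ` parcs H"
    then obtain g where inj: "inj_on g (pverts H)" and sub: "g ` pverts H \<subseteq> pverts G"
      and arcs: "parcs G = map_prod g g ` parcs H"
      by blast
    have "card (pverts G - g ` pverts H) = ?m"
      using sub G.pair_finite_verts H.pair_finite_verts
      by (simp add: card_Diff_subset card_image[OF inj])
    \<comment> \<open>The vertices missed by \<open>g\<close> are as many as the isolated ones added
      to \<open>H\<close>, so any bijection between them extends \<open>g\<close>.\<close>
    then obtain e where e: "bij_betw e {..<?m} (pverts G - g ` pverts H)"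
      using G.pair_finite_verts by (metis bij_betw_from_nat_into_finite finite_Diff)
    have "case_sum g e ` (pverts H <+> {..<?m}) = g ` pverts H \<union> e ` {..<?m}"
      by (auto simp: Plus_def image_Un image_image)
    then have "case_sum g e ` (pverts H <+> {..<?m}) = pverts G"
      using e sub by (auto simp: bij_betw_def)
    moreover have "inj_on (case_sum g e) (pverts H <+> {..<?m})"
    proof (rule inj_onI)
      fix x y
      assume "x \<in> pverts H <+> {..<?m}" "y \<in> pverts H <+> {..<?m}" "case_sum g e x = case_sum g e y"
      then show "x = y"
        using bij_betw_imp_inj_on[OF e] bij_betw_apply[OF e] inj
        by (cases x; cases y) (force dest: inj_onD)+
    qed
    ultimately have "bij_betw (case_sum g e) (pverts H <+> {..<?m}) (pverts G)"
      by (simp add: bij_betw_def)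
    moreover have "case_sum g e \<circ> Inl = g"
      by auto
    ultimately have "G \<simeq> ?H"
      unfolding iso using arcs by (intro exI[of _ "case_sum g e"]) simp
    then show "card (pverts G) \<ge> card (pverts H) \<and> G \<simeq> ?H"
      using card_inj_on_le[OF inj sub G.pair_finite_verts] by blast
  qed
qed

section \<open>The five graphs\<close>

text \<open>Lets each undirected edge be listed once, while \<open>parcs\<close> contains both of
  its orientations.\<close>

abbreviation symcl :: "('a \<times> 'a) set \<Rightarrow> ('a \<times> 'a) set" where
  "symcl E \<equiv> E \<union> E\<inverse>"

lemma map_prod_symcl: "map_prod g g ` symcl E = symcl (map_prod g g ` E)"
proof -
  have "map_prod g g ` E\<inverse> = (map_prod g g ` E)\<inverse>"
    by (auto simp: image_iff Bex_def)
  then show ?thesis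
    by (simp add: image_Un)
qed

lemma less_numeral_iffs:
  fixes i :: nat
  shows "i < 2 \<longleftrightarrow> i = 0 \<or> i = 1"
    and "i < 3 \<longleftrightarrow> i = 0 \<or> i = 1 \<or> i = 2"
    and "i < 4 \<longleftrightarrow> i = 0 \<or> i = 1 \<or> i = 2 \<or> i = 3"
  by linarith+

lemma path_graph_3: "parcs (path_graph 3) = symcl {(0, 1), (1, 2)}"
  by (auto simp: path_graph_def less_numeral_iffs)

lemma path_graph_4: "parcs (path_graph 4) = symcl {(0, 1), (1, 2), (2, 3)}"
  by (auto simp: path_graph_def less_numeral_iffs)

lemma cycle_graph_3: "parcs (cycle_graph 3) = symcl {(0, 1), (1, 2), (0, 2)}"
  by (auto simp: cycle_graph_def less_numeral_iffs)

lemma cycle_graph_4: "parcs (cycle_graph 4) = symcl {(0, 1), (1, 2), (2, 3), (0, 3)}"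
  by (auto simp: cycle_graph_def less_numeral_iffs)

lemma complete_graph_2: "parcs (complete_graph 2) = symcl {(0, 1)}"
  by (auto simp: complete_graph_def less_numeral_iffs)

lemma two_complete_graph_2:
  "parcs (complete_graph 2 \<uplus> complete_graph 2) = symcl {(Inl 0, Inl 1), (Inr 0, Inr 1)}"
  by (auto simp: disjoint_union_def complete_graph_2)

text \<open>An injection on an enumerated finite set is the same thing as the distinct list of its
  values. This replaces embeddings by named vertices.\<close>

lemma ex_inj_on_iff:
  assumes "distinct xs"
  shows "(\<exists>g. inj_on g (set xs) \<and> Q (map g xs)) \<longleftrightarrow>
    (\<exists>ys. length ys = length xs \<and> distinct ys \<and> Q ys)"
proof
  assume "\<exists>g. inj_on g (set xs) \<and> Q (map g xs)"
  then show "\<exists>ys. length ys = length xs \<and> distinct ys \<and> Q ys"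
    using assms by (metis distinct_map length_map)
next
  assume "\<exists>ys. length ys = length xs \<and> distinct ys \<and> Q ys"
  then obtain ys where ys: "length ys = length xs" "distinct ys" "Q ys"
    by blast
  let ?g = "the \<circ> map_of (zip xs ys)"
  have "map ?g xs = ys"
    using assms ys(1) by (auto intro!: nth_equalityI simp: map_of_zip_nth)
  then show "\<exists>g. inj_on g (set xs) \<and> Q (map g xs)"
    using assms ys by (metis distinct_map)
qed

lemma ex_list_3: "(\<exists>ys. length ys = 3 \<and> P ys) \<longleftrightarrow> (\<exists>a b c. P [a, b, c])"
proof
  assume "\<exists>a b c. P [a, b, c]"
  then obtain a b c where "length [a, b, c] = 3 \<and> P [a, b, c]"
    by auto
  then show "\<exists>ys. length ys = 3 \<and> P ys"
    by blast
qed (auto simp: numeral_eq_Suc length_Suc_conv)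

lemma ex_list_4: "(\<exists>ys. length ys = 4 \<and> P ys) \<longleftrightarrow> (\<exists>a b c d. P [a, b, c, d])"
proof
  assume "\<exists>a b c d. P [a, b, c, d]"
  then obtain a b c d where "length [a, b, c, d] = 4 \<and> P [a, b, c, d]"
    by auto
  then show "\<exists>ys. length ys = 4 \<and> P ys"
    by blast
qed (auto simp: numeral_eq_Suc length_Suc_conv)

lemma pverts_simps:
  "pverts (path_graph m) = {..<m}" "pverts (cycle_graph m) = {..<m}"
  "pverts (complete_graph m) = {..<m}" "pverts (G \<uplus> H) = pverts G <+> pverts H"
  by (simp_all add: path_graph_def cycle_graph_def complete_graph_def disjoint_union_def)

context pair_graph
begin

text \<open>\<open>I\<close> records the edges as pairs of list positions, so one set describes
  \<open>H\<close> through \<open>xs\<close> and \<open>G\<close> through \<open>ys\<close>. As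
  \<open>H\<close> has no isolated vertices, equality of the arcs already places the image of the
  embedding inside \<open>pverts G\<close>.\<close>

lemma iso_union_empty_iff_list:
  assumes H: "pair_graph H" "pverts H = Domain (parcs H)"
    and xs: "distinct xs" "set xs = pverts H" "length xs = m"
    and I: "parcs H = symcl ((\<lambda>(i, j). (xs ! i, xs ! j)) ` I)" "I \<subseteq> {..<m} \<times> {..<m}"
  shows "m \<le> card (pverts G) \<and> G \<simeq> H \<uplus> empty_graph (card (pverts G) - m) \<longleftrightarrow>
    (\<exists>ys. length ys = m \<and> distinct ys \<and> parcs G = symcl ((\<lambda>(i, j). (ys ! i, ys ! j)) ` I))"
proof -
  have len: "card (pverts H) = m"
    using xs distinct_card by metis
  have sub: "g ` pverts H \<subseteq> pverts G" if "parcs G = map_prod g g ` parcs H" for g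
  proof -
    have "g ` pverts H \<subseteq> Domain (parcs G)"
      unfolding H(2) that by force
    then show ?thesis
      using Domain_parcs_subset by blast
  qed
  \<comment> \<open>All positions in \<open>I\<close> are below the length of \<open>xs\<close>, so
    \<open>map g xs ! i\<close> is \<open>g (xs ! i)\<close>.\<close>
  have arcs: "map_prod g g ` parcs H = symcl ((\<lambda>(i, j). (map g xs ! i, map g xs ! j)) ` I)" for g
    unfolding I(1) map_prod_symcl image_image
    using I(2) xs(3) by (intro arg_cong[where f = symcl] image_cong) auto
  have "m \<le> card (pverts G) \<and> G \<simeq> H \<uplus> empty_graph (card (pverts G) - m) \<longleftrightarrow>
      (\<exists>g. inj_on g (set xs) \<and> parcs G = map_prod g g ` parcs H)"
    using graph_iso_union_empty_iff[OF pair_graph_axioms H(1)] sub unfolding len xs(2) by blast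
  then show ?thesis
    unfolding arcs using ex_inj_on_iff[OF xs(1)] xs(3) by simp
qed

section \<open>Each of the five isomorphism types as an explicit arc set\<close>

lemma iso_path_graph_3_iff:
  "3 \<le> card (pverts G) \<and> G \<simeq> path_graph 3 \<uplus> empty_graph (card (pverts G) - 3) \<longleftrightarrow>
    (\<exists>a b c. distinct [a, b, c] \<and> parcs G = symcl {(a, b), (b, c)})"
proof -
  have "3 \<le> card (pverts G) \<and> G \<simeq> path_graph 3 \<uplus> empty_graph (card (pverts G) - 3) \<longleftrightarrow>
    (\<exists>ys. length ys = 3 \<and> distinct ys \<and>
      parcs G = symcl ((\<lambda>(i, j). (ys ! i, ys ! j)) ` {(0, 1), (1, 2)}))"
    by (rule iso_union_empty_iff_list[where xs = "[0, 1, 2]"])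
      (auto simp: path_graph_3 pverts_simps less_numeral_iffs pair_graph_path_graph)
  then show ?thesis
    unfolding ex_list_3 by simp
qed

lemma iso_cycle_graph_3_iff:
  "3 \<le> card (pverts G) \<and> G \<simeq> cycle_graph 3 \<uplus> empty_graph (card (pverts G) - 3) \<longleftrightarrow>
    (\<exists>a b c. distinct [a, b, c] \<and> parcs G = symcl {(a, b), (b, c), (a, c)})"
proof -
  have "3 \<le> card (pverts G) \<and> G \<simeq> cycle_graph 3 \<uplus> empty_graph (card (pverts G) - 3) \<longleftrightarrow>
    (\<exists>ys. length ys = 3 \<and> distinct ys \<and>
      parcs G = symcl ((\<lambda>(i, j). (ys ! i, ys ! j)) ` {(0, 1), (1, 2), (0, 2)}))"
    by (rule iso_union_empty_iff_list[where xs = "[0, 1, 2]"])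
      (auto simp: cycle_graph_3 pverts_simps less_numeral_iffs pair_graph_cycle_graph)
  then show ?thesis
    unfolding ex_list_3 by simp
qed

lemma iso_path_graph_4_iff:
  "4 \<le> card (pverts G) \<and> G \<simeq> path_graph 4 \<uplus> empty_graph (card (pverts G) - 4) \<longleftrightarrow>
    (\<exists>a b c d. distinct [a, b, c, d] \<and> parcs G = symcl {(a, b), (b, c), (c, d)})"
proof -
  have "4 \<le> card (pverts G) \<and> G \<simeq> path_graph 4 \<uplus> empty_graph (card (pverts G) - 4) \<longleftrightarrow>
    (\<exists>ys. length ys = 4 \<and> distinct ys \<and>
      parcs G = symcl ((\<lambda>(i, j). (ys ! i, ys ! j)) ` {(0, 1), (1, 2), (2, 3)}))"
    by (rule iso_union_empty_iff_list[where xs = "[0, 1, 2, 3]"])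
      (auto simp: path_graph_4 pverts_simps less_numeral_iffs pair_graph_path_graph)
  then show ?thesis
    unfolding ex_list_4 by simp
qed

lemma iso_cycle_graph_4_iff:
  "4 \<le> card (pverts G) \<and> G \<simeq> cycle_graph 4 \<uplus> empty_graph (card (pverts G) - 4) \<longleftrightarrow>
    (\<exists>a b c d. distinct [a, b, c, d] \<and> parcs G = symcl {(a, b), (b, c), (c, d), (a, d)})"
proof -
  have "4 \<le> card (pverts G) \<and> G \<simeq> cycle_graph 4 \<uplus> empty_graph (card (pverts G) - 4) \<longleftrightarrow>
    (\<exists>ys. length ys = 4 \<and> distinct ys \<and>
      parcs G = symcl ((\<lambda>(i, j). (ys ! i, ys ! j)) ` {(0, 1), (1, 2), (2, 3), (0, 3)}))"
    by (rule iso_union_empty_iff_list[where xs = "[0, 1, 2, 3]"])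
      (auto simp: cycle_graph_4 pverts_simps less_numeral_iffs pair_graph_cycle_graph)
  then show ?thesis
    unfolding ex_list_4 by simp
qed

lemma iso_two_complete_graph_2_iff:
  "4 \<le> card (pverts G) \<and> G \<simeq> complete_graph 2 \<uplus> complete_graph 2 \<uplus> empty_graph (card (pverts G) - 4) \<longleftrightarrow>
    (\<exists>a b c d. distinct [a, b, c, d] \<and> parcs G = symcl {(a, b), (c, d)})"
proof -
  have "4 \<le> card (pverts G) \<and> G \<simeq> complete_graph 2 \<uplus> complete_graph 2 \<uplus> empty_graph (card (pverts G) - 4) \<longleftrightarrow>
    (\<exists>ys. length ys = 4 \<and> distinct ys \<and>
      parcs G = symcl ((\<lambda>(i, j). (ys ! i, ys ! j)) ` {(0, 1), (2, 3)}))"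
    by (rule iso_union_empty_iff_list[where xs = "[Inl 0, Inl 1, Inr 0, Inr 1]"])
      (auto simp: two_complete_graph_2 pverts_simps less_numeral_iffs pair_graph_disjoint_union pair_graph_complete_graph)
  then show ?thesis
    unfolding ex_list_4 by simp
qed

section \<open>Graphs whose largest outward sets have two vertices\<close>

text \<open>By symmetry, the outside neighbor of a vertex of \<open>U\<close> is itself
  non-isolated.\<close>

lemma outward_psubset_Domain:
  assumes "outward G U" "U \<noteq> {}"
  shows "U \<subset> Domain (parcs G)"
proof -
  obtain u v where "(u, v) \<in> parcs G" "v \<notin> U"
    using assms unfolding outward_def by blast
  then show ?thesis
    using outward_subset_Domain[OF assms(1)] sym_parcs by blast
qed

text \<open>A nonempty outward set misses one of the at most three non-isolated vertices. Stated for
  subgraphs of a triangle to serve both three-vertex types.\<close>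

lemma card_outward_le_2_of_triangle:
  assumes "parcs G \<subseteq> symcl {(a, b), (b, c), (a, c)}" and U: "outward G U"
  shows "card U \<le> 2"
proof (cases "U = {}")
  case False
  have "Domain (parcs G) \<subseteq> {a, b, c}"
    using assms(1) by auto
  then have "U \<subset> {a, b, c}"
    using outward_psubset_Domain[OF U False] by blast
  then have "card U < card {a, b, c}"
    by (simp add: psubset_card_mono)
  moreover have "card {a, b, c} \<le> 3"
    by (simp add: card_insert_if)
  ultimately show ?thesis
    by linarith
qed simp

text \<open>All neighbors of a vertex lie in the opposite pair, {a, c} or {b, d}, so an outward set
  meeting one pair cannot contain the whole other pair. All three four-vertex types are subgraphs of
  this square.\<close>

lemma card_outward_le_2_of_square:
  assumes "distinct [a, b, c, d]" "parcs G \<subseteq> symcl {(a, b), (b, c), (c, d), (a, d)}"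
    and U: "outward G U"
  shows "card U \<le> 2"
proof -
  have "U \<subseteq> {a, b, c, d}"
    using outward_subset_Domain[OF U] assms(2) by auto
  moreover have "\<not> {a, c} \<subseteq> U" if u: "u \<in> U" "u \<in> {b, d}" for u
  proof -
    obtain v where v: "(u, v) \<in> parcs G" "v \<notin> U"
      using bspec[OF U[unfolded outward_def] u(1)] by auto
    have "v \<in> {a, c}"
      using assms(1) subsetD[OF assms(2) v(1)] u(2) by auto
    then show ?thesis
      using v(2) by auto
  qed
  moreover have "\<not> {b, d} \<subseteq> U" if u: "u \<in> U" "u \<in> {a, c}" for u
  proof -
    obtain v where v: "(u, v) \<in> parcs G" "v \<notin> U"
      using bspec[OF U[unfolded outward_def] u(1)] by auto
    have "v \<in> {b, d}"
      using assms(1) subsetD[OF assms(2) v(1)] u(2) by auto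
    then show ?thesis
      using v(2) by auto
  qed
  ultimately have "\<exists>x y. U \<subseteq> {x, y}"
    by (cases "a \<in> U"; cases "b \<in> U"; cases "c \<in> U"; cases "d \<in> U") blast+
  then obtain x y where "U \<subseteq> {x, y}"
    by blast
  then have "card U \<le> card {x, y}"
    by (simp add: card_mono)
  also have "\<dots> \<le> 2"
    by (simp add: card_insert_if)
  finally show ?thesis .
qed

text \<open>For an explicit finite \<open>W\<close>, the last hypothesis becomes a check of finitely
  many pairs.\<close>

lemma parcs_eqI:
  assumes "Domain (parcs G) \<subseteq> W" "E \<subseteq> parcs G"
    and "\<forall>x\<in>W. \<forall>y\<in>W. (x, y) \<in> parcs G \<longrightarrow> (x, y) \<in> symcl E"
  shows "parcs G = symcl E"
proof
  show "symcl E \<subseteq> parcs G"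
    using assms(2) sym_parcs by auto
next
  show "parcs G \<subseteq> symcl E"
  proof (rule subrelI)
    fix x y assume xy: "(x, y) \<in> parcs G"
    then have "x \<in> W" "y \<in> W"
      using assms(1) sym_parcs by blast+
    then show "(x, y) \<in> symcl E"
      using xy assms(3) by blast
  qed
qed

text \<open>From right to left, {a, c} is an outward pair in every case, and the triangle or square
  bound excludes triples. Conversely, the split is on whether two edges share a vertex: if so, a
  path a, b, c is completed to one of four types; if not, the edges form a matching.\<close>

lemma outward_number_2_iff:
  "(\<exists>U. outward G U \<and> card U = 2) \<and> \<not> (\<exists>U. outward G U \<and> card U = 3) \<longleftrightarrow>
    (\<exists>a b c. distinct [a, b, c] \<and> parcs G = symcl {(a, b), (b, c)}) \<or>
    (\<exists>a b c. distinct [a, b, c] \<and> parcs G = symcl {(a, b), (b, c), (a, c)}) \<or>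
    (\<exists>a b c d. distinct [a, b, c, d] \<and> parcs G = symcl {(a, b), (b, c), (c, d)}) \<or>
    (\<exists>a b c d. distinct [a, b, c, d] \<and> parcs G = symcl {(a, b), (b, c), (c, d), (a, d)}) \<or>
    (\<exists>a b c d. distinct [a, b, c, d] \<and> parcs G = symcl {(a, b), (c, d)})"
  (is "?L \<longleftrightarrow> ?P3 \<or> ?C3 \<or> ?P4 \<or> ?C4 \<or> ?K")
proof
  have triangle: ?L
    if "distinct [a, b, c]" "parcs G \<subseteq> symcl {(a, b), (b, c), (a, c)}"
      "(a, b) \<in> parcs G" "(c, b) \<in> parcs G" for a b c
  proof -
    have "outward G {a, c}" "card {a, c} = 2"
      using that by (auto simp: outward_def)
    then show ?L
      using card_outward_le_2_of_triangle[OF that(2)] by fastforce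
  qed
  have square: ?L
    if "distinct [a, b, c, d]" "parcs G \<subseteq> symcl {(a, b), (b, c), (c, d), (a, d)}"
      "(a, b) \<in> parcs G" "(c, d) \<in> parcs G" for a b c d
  proof -
    have "outward G {a, c}" "card {a, c} = 2"
      using that by (auto simp: outward_def)
    then show ?L
      using card_outward_le_2_of_square[OF that(1,2)] by fastforce
  qed
  assume "?P3 \<or> ?C3 \<or> ?P4 \<or> ?C4 \<or> ?K"
  then show ?L
    by (elim disjE exE conjE) (erule triangle square; auto)+
next
  assume ?L
  then obtain U where U: "outward G U" "card U = 2"
    and no: "\<And>U. outward G U \<Longrightarrow> card U \<noteq> 3"
    by blast
  let ?W = "Domain (parcs G)"
  have le: "card U \<le> 2" if "outward G U" for U
    using outward_card_smaller[OF that, of 3] no by force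
  have W4: "card ?W \<le> 4"
    using card_Domain_parcs_le[OF le] by simp
  have "U \<subset> ?W"
    using U outward_psubset_Domain by force
  then have W3: "3 \<le> card ?W"
    using psubset_card_mono[OF finite_Domain_parcs, of U] U(2) by simp
  \<comment> \<open>Three neighbors of \<open>x\<close> form an outward triple, each having
    \<open>x\<close> as its outside neighbor. Hence all degrees are at most 2.\<close>
  have deg: False if "(x, p) \<in> parcs G" "(x, q) \<in> parcs G" "(x, r) \<in> parcs G" "distinct [p, q, r]"
    for x p q r
  proof -
    have "x \<notin> {p, q, r}"
      using that no_loops by auto
    then have "outward G {p, q, r}"
      using that(1-3) sym_parcs unfolding outward_def by blast
    then show False
      using no that(4) by force
  qed
  have sym_iff: "(u, v) \<in> parcs G \<longleftrightarrow> (v, u) \<in> parcs G" for u v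
    using sym_parcs by blast
  have W: "\<exists>y\<in>?W. y \<notin> X" if "card X < card ?W" "finite X" for X
    using that by (meson card_mono leD subsetI)
  have W_eq: "?W = X" if "X \<subseteq> ?W" "card X = 4" for X
    using that W4 by (metis card_seteq finite_Domain_parcs)
  show "?P3 \<or> ?C3 \<or> ?P4 \<or> ?C4 \<or> ?K"
  proof (cases "\<exists>a b c. a \<noteq> c \<and> (a, b) \<in> parcs G \<and> (b, c) \<in> parcs G")
    case True
    then obtain a b c where abc: "a \<noteq> c" "(a, b) \<in> parcs G" "(b, c) \<in> parcs G"
      by blast
    then have ne: "a \<noteq> b" "b \<noteq> c" and abc': "(b, a) \<in> parcs G" "(c, b) \<in> parcs G"
      using no_loops sym_parcs by blast+
    have abcW: "{a, b, c} \<subseteq> ?W"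
      using abc abc' by blast
    show ?thesis
    proof (cases "card ?W = 3")
      case True
      then have W': "?W = {a, b, c}"
        using abcW abc(1) ne card_seteq[OF finite_Domain_parcs abcW] by simp
      have distinct: "distinct [a, b, c]"
        using abc ne by simp
      show ?thesis
      proof (cases "(a, c) \<in> parcs G")
        case True
        then have "parcs G = symcl {(a, b), (b, c), (a, c)}"
          using W' abc sym_iff[of a c] no_loops
          by (intro parcs_eqI[where W = "{a, b, c}"]) auto
        with distinct have ?C3
          by (intro exI conjI)
        then show ?thesis
          by simp
      next
        case False
        then have "parcs G = symcl {(a, b), (b, c)}"
          using W' abc sym_iff[of a c] no_loops
          by (intro parcs_eqI[where W = "{a, b, c}"]) auto
        with distinct have ?P3
          by (intro exI conjI)
        then show ?thesis
          by simp
      qed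
    next
      case False
      then have "card {a, b, c} < card ?W"
        using W3 abc(1) ne by simp
      then obtain d where d: "d \<in> ?W" "d \<notin> {a, b, c}"
        using W[of "{a, b, c}"] by auto
      then have W': "?W = {a, b, c, d}"
        using abcW abc(1) ne by (intro W_eq) auto
      \<comment> \<open>The two neighbors \<open>a\<close> and \<open>c\<close> exhaust the degree
        of \<open>b\<close>, so \<open>d\<close> can attach only to \<open>a\<close> or
        \<open>c\<close>.\<close>
      have bd: "(b, d) \<notin> parcs G" "(d, b) \<notin> parcs G"
        using deg[of b a c d] abc(1,3) abc'(1) d(2) sym_iff[of b d] by auto
      obtain x where x: "(x, d) \<in> parcs G"
        using d(1) sym_parcs by blast
      then have "x \<in> {a, b, c, d}"
        using W' by blast
      then have e: "(a, d) \<in> parcs G \<or> (c, d) \<in> parcs G"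
        using x bd no_loops by auto
      \<comment> \<open>The end adjacent to \<open>d\<close> is also adjacent to \<open>b\<close>;
        the edge between \<open>a\<close> and \<open>c\<close> would be its third.\<close>
      have ac: "(a, c) \<notin> parcs G" "(c, a) \<notin> parcs G"
        using deg[of a b c d] deg[of c b a d] e abc abc' ne d(2) sym_iff[of a c] by auto
      consider "(a, d) \<in> parcs G" "(c, d) \<in> parcs G" | "(a, d) \<notin> parcs G" "(c, d) \<in> parcs G"
        | "(a, d) \<in> parcs G" "(c, d) \<notin> parcs G"
        using e by blast
      then show ?thesis
      proof cases
        case 1
        then have "parcs G = symcl {(a, b), (b, c), (c, d), (a, d)}"
          using W' abc ac bd no_loops sym_iff[of a d] sym_iff[of c d]
          by (intro parcs_eqI[where W = "{a, b, c, d}"]) auto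
        moreover have "distinct [a, b, c, d]"
          using abc(1) ne d(2) by auto
        ultimately have ?C4
          by (intro exI conjI)
        then show ?thesis
          by simp
      next
        case 2
        then have "parcs G = symcl {(a, b), (b, c), (c, d)}"
          using W' abc ac bd no_loops sym_iff[of a d] sym_iff[of c d]
          by (intro parcs_eqI[where W = "{a, b, c, d}"]) auto
        moreover have "distinct [a, b, c, d]"
          using abc(1) ne d(2) by auto
        ultimately have ?P4
          by (intro exI conjI)
        then show ?thesis
          by simp
      next
        case 3
        \<comment> \<open>The path now starts at \<open>d\<close>, hence the rotated order of the
          witnesses.\<close>
        then have "parcs G = symcl {(d, a), (a, b), (b, c)}"
          using W' abc ac bd no_loops sym_iff[of a d] sym_iff[of c d]
          by (intro parcs_eqI[where W = "{a, b, c, d}"]) auto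
        moreover have "distinct [d, a, b, c]"
          using abc(1) ne d(2) by auto
        ultimately have ?P4
          by (intro exI conjI)
        then show ?thesis
          by simp
      qed
    qed
  next
    case False
    then have no_path: "a = c" if "(a, b) \<in> parcs G" "(b, c) \<in> parcs G" for a b c
      using that by blast
    obtain a b where ab: "(a, b) \<in> parcs G"
      using W[of "{}"] W3 by auto
    then have "card {a, b} < card ?W"
      using W3 by (simp add: card_insert_if)
    then obtain c where "c \<in> ?W" "c \<notin> {a, b}"
      using W[of "{a, b}"] by auto
    then obtain d where cd: "(c, d) \<in> parcs G" "c \<notin> {a, b}"
      by blast
    have ba: "(b, a) \<in> parcs G" and dc: "(d, c) \<in> parcs G"
      using ab cd(1) sym_parcs by blast+
    \<comment> \<open>If \<open>d\<close> were \<open>a\<close> or \<open>b\<close>, the two edges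
      would share a vertex. So they are disjoint and use up the at most four non-isolated
      vertices.\<close>
    have distinct: "distinct [a, b, c, d]"
      using ab cd dc no_loops no_path[OF ab, of c] no_path[OF ba, of c] by auto
    have "{a, b, c, d} \<subseteq> ?W"
      using ab ba cd(1) dc by (simp add: DomainI)
    moreover have "card {a, b, c, d} = 4"
      using distinct by simp
    ultimately have W': "?W = {a, b, c, d}"
      by (rule W_eq)
    have none: "(a, c) \<notin> parcs G" "(a, d) \<notin> parcs G" "(b, c) \<notin> parcs G" "(b, d) \<notin> parcs G"
      using distinct no_path[OF ba] no_path[OF ab] by (metis distinct_length_2_or_more)+
    have "parcs G = symcl {(a, b), (c, d)}"
    proof (rule parcs_eqI[where W = "{a, b, c, d}"])
      show "\<forall>x\<in>{a, b, c, d}. \<forall>y\<in>{a, b, c, d}. (x, y) \<in> parcs G \<longrightarrow> (x, y) \<in> symcl {(a, b), (c, d)}"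
        using no_loops none none[unfolded sym_iff[of a] sym_iff[of b]] by simp
    qed (use W' ab cd in auto)
    with distinct have ?K
      by (intro exI conjI)
    then show ?thesis
      by simp
  qed
qed

end

text \<open>The guards on \<open>n\<close> discard a graph for which the number of isolated vertices
  to add would be negative, where natural subtraction would give 0.\<close>

theorem theorem17:
  fixes G :: "'a pair_pre_digraph" and n :: nat
  assumes "pair_graph G" and "pverts G \<noteq> {}" and "card (pverts G) = n"
  shows "pd_throttling G = n - 1 \<longleftrightarrow>
    (n \<ge> 3 \<and> G \<simeq> path_graph 3 \<uplus> empty_graph (n - 3)) \<or>
    (n \<ge> 3 \<and> G \<simeq> cycle_graph 3 \<uplus> empty_graph (n - 3)) \<or>
    (n \<ge> 4 \<and> G \<simeq> path_graph 4 \<uplus> empty_graph (n - 4)) \<or>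
    (n \<ge> 4 \<and> G \<simeq> cycle_graph 4 \<uplus> empty_graph (n - 4)) \<or>
    (n \<ge> 4 \<and> G \<simeq> complete_graph 2 \<uplus> complete_graph 2 \<uplus> empty_graph (n - 4))"
proof -
  interpret pair_graph G by fact
  show ?thesis
    unfolding assms(3)[symmetric] pd_throttling_eq_iff_outward[OF assms(2)] outward_number_2_iff
      iso_path_graph_3_iff iso_cycle_graph_3_iff iso_path_graph_4_iff iso_cycle_graph_4_iff
      iso_two_complete_graph_2_iff ..
qed

end
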